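(* There is an absolute constant $c>0$ such that for every $n\ge1$ and every preorder sequence $S=(s_1,\dots,s_n)$ (a permutation of $[n]$ avoiding the pattern $(2,3,1)$), taking the initial tree $I_p=\mathcal{M}(S)=\{(s_i,-i): i\in[n]\}$, we have $\textsc{Greedy}_{I_p}(S)\le c\,n$; that is, $\textsc{Greedy}_{I_p}(S)=O(n)$.
   Context: A permutation $(a_1,\dots,a_n)$ avoids the pattern $(2,3,1)$ if there are no indices $i<j<k$ with $a_k<a_i<a_j$; equivalently it is the preorder traversal of some binary search tree on $[n]$. Geometric view of binary search trees: a search sequence $S=(s_1,\dots,s_n)$ is the point set $\{(s_i,i)\}$ (x = key, y = time); the mirror $\mathcal{M}(S)$ is its reflection across the $x$-axis. An initial tree is a finite set of points with negative $y$-coordinates present before any search. For two points $p,q$ not on a common horizontal or vertical line, $\square_{pq}$ denotes the closed axis-parallel rectangle with corners $p,q$. The algorithm $\textsc{Greedy}$ with initial tree $I$ on $S$: start with $X:=I$; for $i=1,\dots,n$ in order, let $X_{<i}$ be the current set (all points with $y<i$); for every point $z\in X_{<i}$ with $z.x\neq s_i$ such that $\square_{(s_i,i)z}$ contains no point of $X_{<i}\cup\{(s_i,i)\}$ other than its two corners, add the point $(z.x,i)$ (a touched point); then add $(s_i,i)$ and all these touched points to $X$. The cost $\textsc{Greedy}_I(S)$ is $n$ plus the total number of touched points added over all times $1,\dots,n$. *)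

theory Defs
  imports Complex_Main "HOL-Combinatorics.Multiset_Permutations"
begin

text \<open>Points of the plane: the first coordinate is the key, the second one is the time.\<close>

type_synonym point = "nat \<times> int"

definition rect :: "point \<Rightarrow> point \<Rightarrow> point set" where
  "rect p q = {min (fst p) (fst q)..max (fst p) (fst q)} \<times> {min (snd p) (snd q)..max (snd p) (snd q)}"

text \<open>A search sequence \<open>(s\<^sub>1, \<dots>, s\<^sub>n)\<close> is a list; since list positions are counted from \<open>0\<close>, the key
  \<open>s\<^sub>i\<close> searched at time \<open>i\<close> is \<open>S ! (i - 1)\<close>.\<close>

definition search_point :: "nat list \<Rightarrow> nat \<Rightarrow> point" where
  "search_point S i = (S ! (i - 1), int i)"

definition search_points :: "nat list \<Rightarrow> point set" where
  "search_points S = search_point S ` {1..length S}"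

definition mirror :: "point set \<Rightarrow> point set" where
  "mirror P = (\<lambda>(x, y). (x, - y)) ` P"

definition initial_tree :: "point set \<Rightarrow> bool" where
  "initial_tree I \<longleftrightarrow> finite I \<and> (\<forall>p\<in>I. snd p < 0)"

lemma initial_tree_mirror: "initial_tree (mirror (search_points S))"
  by (auto simp: initial_tree_def mirror_def search_points_def search_point_def)

definition avoids_231 :: "nat list \<Rightarrow> bool" where
  "avoids_231 S \<longleftrightarrow> \<not> (\<exists>i j k. i < j \<and> j < k \<and> k < length S \<and> S ! k < S ! i \<and> S ! i < S ! j)"

definition preorder_sequence :: "nat \<Rightarrow> nat list \<Rightarrow> bool" where
  "preorder_sequence n S \<longleftrightarrow> S \<in> permutations_of_set {1..n} \<and> avoids_231 S"

definition touched :: "point set \<Rightarrow> point \<Rightarrow> point set" where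
  "touched X p =
     {(fst z, snd p) | z. z \<in> X \<and> fst z \<noteq> fst p \<and> rect p z \<inter> (X \<union> {p}) \<subseteq> {p, z}}"

text \<open>\<open>greedy I S i\<close> is the point set after the searches at times \<open>1, \<dots>, i\<close>. If \<open>I\<close> is an initial tree,
  its points have time at most \<open>i\<close>, so that \<open>greedy I S (i - 1)\<close> is the point set
  that the search at time \<open>i\<close> finds, and it lies entirely below time \<open>i\<close>.\<close>

primrec greedy :: "point set \<Rightarrow> nat list \<Rightarrow> nat \<Rightarrow> point set" where
  "greedy I S 0 = I"
| "greedy I S (Suc i) =
     greedy I S i \<union> {search_point S (Suc i)} \<union> touched (greedy I S i) (search_point S (Suc i))"

definition greedy_cost :: "point set \<Rightarrow> nat list \<Rightarrow> nat" where
  "greedy_cost I S =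
     length S + (\<Sum>i = 1..length S. card (touched (greedy I S (i - 1)) (search_point S i)))"

lemma finite_touched: "finite X \<Longrightarrow> finite (touched X p)"
  by (rule finite_subset[of _ "(\<lambda>z. (fst z, snd p)) ` X"]) (unfold touched_def, blast, simp)

lemma finite_greedy: "initial_tree I \<Longrightarrow> finite (greedy I S i)"
  by (induction i) (auto simp: initial_tree_def finite_touched)

lemma greedy_time_le: "initial_tree I \<Longrightarrow> p \<in> greedy I S i \<Longrightarrow> snd p \<le> int i"
  by (induction i arbitrary: p)
     (fastforce simp: initial_tree_def touched_def search_point_def)+

end

theory Submission
  imports Defs
begin

text \<open>A key that has not been searched before time \<open>i\<close> is never touched at time \<open>i\<close>, because the initial
  point \<open>(s\<^sub>i, -i)\<close> hides it. Right of \<open>s\<^sub>i\<close> at most one key is touched: among searched keys \<open>a < b\<close> right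
  of \<open>s\<^sub>i\<close>, avoidance forces \<open>b\<close> to be searched before \<open>a\<close>, and all searches between that of \<open>a\<close> and time
  \<open>i\<close> to lie left of \<open>a\<close>, so \<open>b\<close> was never touched later than \<open>a\<close>. Left of \<open>s\<^sub>i\<close>, if \<open>s\<^sub>i < s\<^sub>i\<^sub>-\<^sub>1\<close>, only the
  predecessor of \<open>s\<^sub>i\<close> among the searched keys is touched, since it was already touched at time \<open>i - 1\<close>. If
  \<open>s\<^sub>i\<^sub>-\<^sub>1 < s\<^sub>i\<close>, all touched keys left of \<open>s\<^sub>i\<close> are searched keys in \<open>[s\<^sub>i\<^sub>-\<^sub>1, s\<^sub>i)\<close>, and avoidance makes these
  sets disjoint for different \<open>i\<close>. The cost is therefore at most \<open>4n\<close>.\<close>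

section \<open>Preorder sequences indexed by time\<close>

locale preorder_search =
  fixes S :: "nat list"
  assumes distinct: "distinct S" and avoids: "avoids_231 S"
begin

abbreviation G :: "nat \<Rightarrow> point set" where
  "G \<equiv> greedy (mirror (search_points S)) S"

definition key :: "nat \<Rightarrow> nat" where
  "key i = S ! (i - 1)"

lemma search_point_eq: "search_point S i = (key i, int i)"
  by (simp add: search_point_def key_def)

definition touch :: "nat \<Rightarrow> nat set" where
  "touch i = fst ` touched (G (i - 1)) (search_point S i)"

lemma key_inj: "\<lbrakk>key i = key j; 1 \<le> i; i \<le> length S; 1 \<le> j; j \<le> length S\<rbrakk> \<Longrightarrow> i = j"
  using distinct nth_eq_iff_index_eq[of S "i - 1" "j - 1"] by (simp add: key_def eq_diff_iff)

lemma no_231: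
  assumes "1 \<le> i" "i < j" "j < k" "k \<le> length S" "key k < key i" "key i < key j"
  shows False
proof -
  have "i - 1 < j - 1" "j - 1 < k - 1" "k - 1 < length S" using assms by auto
  then show False using avoids assms(5,6) unfolding avoids_231_def key_def by blast
qed

section \<open>Points placed by Greedy\<close>

lemma initial_iff: "p \<in> mirror (search_points S) \<longleftrightarrow> (\<exists>j\<in>{1..length S}. p = (key j, - int j))"
  by (auto simp: mirror_def search_points_def search_point_eq image_iff)

lemma greedy_mono: "i \<le> j \<Longrightarrow> G i \<subseteq> G j"
  by (induction j) (auto simp: le_Suc_eq)

lemma initial_in_greedy: "\<lbrakk>1 \<le> j; j \<le> length S\<rbrakk> \<Longrightarrow> (key j, - int j) \<in> G i"
  using greedy_mono[of 0 i] initial_iff[of "(key j, - int j)"] by auto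

lemma time_le: "(x, t) \<in> G i \<Longrightarrow> t \<le> int i"
  using greedy_time_le[OF initial_tree_mirror] by fastforce

lemma search_in_greedy: "\<lbrakk>1 \<le> j; j \<le> i\<rbrakk> \<Longrightarrow> (key j, int j) \<in> G i"
  using greedy_mono[of j i] by (cases j) (auto simp: search_point_eq)

text \<open>All points of \<open>G (i - 1)\<close> lie strictly below time \<open>i\<close>, so the
  upper side of the rectangle never matters and only the bound \<open>t\<close> from below remains.
  As \<open>y = x\<close> is allowed, \<open>t\<close> is the latest time of a point with key
  \<open>x\<close>.\<close>

lemma touch_iff:
  assumes "1 \<le> i"
  shows "x \<in> touch i \<longleftrightarrow> x \<noteq> key i \<and>
    (\<exists>t. (x, t) \<in> G (i - 1) \<and>
      (\<forall>y u. (y, u) \<in> G (i - 1) \<longrightarrow> min x (key i) \<le> y \<longrightarrow> y \<le> max x (key i) \<longrightarrow> t \<le> u \<longrightarrow> (y, u) = (x, t)))"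
    (is "_ \<longleftrightarrow> ?R")
proof -
  have le: "u \<le> int i" "u \<noteq> int i" if "(y, u) \<in> G (i - 1)" for y u
    using time_le[OF that] assms by auto
  have "x \<in> touch i \<longleftrightarrow> x \<noteq> key i \<and> (\<exists>t. (x, t) \<in> G (i - 1) \<and>
      rect (key i, int i) (x, t) \<inter> (G (i - 1) \<union> {(key i, int i)}) \<subseteq> {(key i, int i), (x, t)})"
    by (force simp: touch_def touched_def search_point_eq image_iff)
  also have "\<dots> \<longleftrightarrow> ?R"
  proof -
    have "rect (key i, int i) (x, t) \<inter> (G (i - 1) \<union> {(key i, int i)}) \<subseteq> {(key i, int i), (x, t)} \<longleftrightarrow>
      (\<forall>y u. (y, u) \<in> G (i - 1) \<longrightarrow> min x (key i) \<le> y \<longrightarrow> y \<le> max x (key i) \<longrightarrow> t \<le> u \<longrightarrow> (y, u) = (x, t))"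
      if "(x, t) \<in> G (i - 1)" for t
      using le[OF that] le by (fastforce simp: rect_def min.commute max.commute)
    then show ?thesis by blast
  qed
  finally show ?thesis .
qed

lemma greedy_cases:
  assumes "(x, t) \<in> G i"
  obtains (initial) j where "1 \<le> j" "j \<le> length S" "x = key j" "t = - int j"
  | (search) j where "1 \<le> j" "j \<le> i" "x = key j" "t = int j"
  | (touch) j where "1 \<le> j" "j \<le> i" "x \<in> touch j" "t = int j"
proof -
  have "(\<exists>j. 1 \<le> j \<and> j \<le> length S \<and> x = key j \<and> t = - int j) \<or>
    (\<exists>j. 1 \<le> j \<and> j \<le> i \<and> (x = key j \<or> x \<in> touch j) \<and> t = int j)"
    using assms
  proof (induction i)
    case 0
    then show ?case by (auto simp: initial_iff)
  next
    case (Suc i)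
    consider "(x, t) \<in> G i" | "(x, t) = search_point S (Suc i)"
      | "(x, t) \<in> touched (G i) (search_point S (Suc i))"
      using Suc.prems by auto
    then show ?case
    proof cases
      case 1
      then show ?thesis using Suc.IH by (meson le_SucI)
    next
      case 2
      then show ?thesis by (intro disjI2 exI[of _ "Suc i"]) (auto simp: search_point_eq)
    next
      case 3
      then have "x \<in> touch (Suc i)" by (force simp: touch_def)
      moreover have "t = int (Suc i)" using 3 by (auto simp: touched_def search_point_eq)
      ultimately show ?thesis by (intro disjI2 exI[of _ "Suc i"]) simp
    qed
  qed
  then show ?thesis using initial search touch by metis
qed

section \<open>Which keys a search can touch\<close>

lemma touch_in_greedy:
  assumes "x \<in> touch i" "1 \<le> i"
  shows "(x, int i) \<in> G i"
proof -
  have "(x, int i) \<in> touched (G (i - 1)) (search_point S i)"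
    using assms(1) by (auto simp: touch_def touched_def search_point_eq)
  then show ?thesis using assms(2) by (cases i) auto
qed

lemma touch_searched:
  assumes "x \<in> touch i" "1 \<le> i" "i \<le> length S"
  obtains j where "1 \<le> j" "j < i" "x = key j"
proof -
  have "\<exists>j. 1 \<le> j \<and> j < i \<and> x = key j"
    using assms
  proof (induction i rule: less_induct)
    case (less i)
    obtain t where ne: "x \<noteq> key i" and t: "(x, t) \<in> G (i - 1)"
      and empty: "\<And>y u. \<lbrakk>(y, u) \<in> G (i - 1); min x (key i) \<le> y; y \<le> max x (key i); t \<le> u\<rbrakk>
        \<Longrightarrow> (y, u) = (x, t)"
      using less.prems touch_iff by blast
    from t show ?case
    proof (cases rule: greedy_cases)
      case (initial j)
      \<comment> \<open>Otherwise the initial point of \<open>x\<close> is at time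
        \<open>- int i\<close> or below, and the initial point of \<open>key i\<close> lies in the
        rectangle.\<close>
      have "j < i"
      proof (rule ccontr)
        assume "\<not> j < i"
        then have "(key i, - int i) = (x, t)"
          using initial less.prems by (intro empty initial_in_greedy) auto
        then show False using ne by simp
      qed
      then show ?thesis using initial by blast
    next
      case (search j)
      then show ?thesis using less.prems by (intro exI[of _ j]) auto
    next
      case (touch j)
      then obtain k where "1 \<le> k" "k < j" "x = key k" using less.IH[of j] less.prems by fastforce
      then show ?thesis using touch less.prems by (intro exI[of _ k]) auto
    qed
  qed
  then show ?thesis using that by blast
qed

text \<open>Prepares the blocking arguments: \<open>t\<close> is the latest time of
  \<open>x\<close>, so a touch is refuted by any point of another key in between that is at time
  \<open>t\<close> or later.\<close>

lemma touchE:
  assumes "x \<in> touch i" "1 \<le> i" "i \<le> length S"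
  obtains j t where "1 \<le> j" "j < i" "x = key j" "j \<le> t" "t < i" "t = j \<or> x \<in> touch t"
    "\<And>y u. \<lbrakk>(y, u) \<in> G (i - 1); min x (key i) \<le> y; y \<le> max x (key i); y \<noteq> x\<rbrakk> \<Longrightarrow> u < int t"
proof -
  obtain j where j: "1 \<le> j" "j < i" "x = key j" using touch_searched assms by blast
  obtain t where t: "(x, t) \<in> G (i - 1)"
    and empty: "\<And>y u. \<lbrakk>(y, u) \<in> G (i - 1); min x (key i) \<le> y; y \<le> max x (key i); t \<le> u\<rbrakk>
      \<Longrightarrow> (y, u) = (x, t)"
    using assms touch_iff by blast
  have "int j \<le> t"
  proof (rule ccontr)
    assume "\<not> int j \<le> t"
    then have "(x, int j) = (x, t)" using j by (intro empty) (auto simp: search_in_greedy)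
    then show False using \<open>\<not> int j \<le> t\<close> by simp
  qed
  from t have "\<exists>k<i. t = int k \<and> (k = j \<or> x \<in> touch k)"
  proof (cases rule: greedy_cases)
    case (initial k)
    then show ?thesis using \<open>int j \<le> t\<close> j by simp
  next
    case (search k)
    then have "k = j" using key_inj[of k j] j assms by auto
    then show ?thesis using search j by auto
  next
    case (touch k)
    then show ?thesis using j by (intro exI[of _ k]) auto
  qed
  then obtain k where k: "k < i" "t = int k" "k = j \<or> x \<in> touch k" by blast
  show ?thesis
  proof (rule that[of j k])
    show "u < int k" if "(y, u) \<in> G (i - 1)" "min x (key i) \<le> y" "y \<le> max x (key i)" "y \<noteq> x" for y u
      using empty[OF that(1-3)] that(4) k by force
  qed (use j k \<open>int j \<le> t\<close> in auto)
qed

text \<open>The point searched at time \<open>j\<close> separates \<open>x\<close> from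
  \<open>key i\<close>, so a touch of \<open>x\<close> at time \<open>i\<close> needs an earlier
  touch of \<open>x\<close> strictly between \<open>j\<close> and \<open>i\<close>. Avoidance puts
  the search at that time left of \<open>key j\<close> too, and induction on time applies.\<close>

lemma not_touch_right:
  assumes "1 \<le> j" "j < i" "i \<le> length S" "key i < key j" "key j < x"
  shows "x \<notin> touch i"
  using assms(2-4)
proof (induction i rule: less_induct)
  case (less i)
  show ?case
  proof
    assume "x \<in> touch i"
    then obtain k t where k: "1 \<le> k" "k < i" "x = key k" "k \<le> t" "t < i" "t = k \<or> x \<in> touch t"
      and latest: "\<And>y u. \<lbrakk>(y, u) \<in> G (i - 1); min x (key i) \<le> y; y \<le> max x (key i); y \<noteq> x\<rbrakk>
        \<Longrightarrow> u < int t"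
      by (rule touchE) (use less.prems in auto)
    have "int j < int t"
      using less.prems assms(1,5) by (intro latest[of "key j"] search_in_greedy) auto
    \<comment> \<open>A search of \<open>x\<close> after time \<open>j\<close> would complete the
      pattern at \<open>j\<close>, \<open>k\<close>, \<open>i\<close>.\<close>
    have "k \<le> j" using no_231[of j k i] assms(1,5) less.prems k by force
    then have "x \<in> touch t" using k \<open>int j < int t\<close> by auto
    moreover have "key t \<noteq> key j" using key_inj[of t j] assms(1) k less.prems \<open>int j < int t\<close> by auto
    then have "key t < key j"
      using no_231[of j t i] assms(1) less.prems k \<open>int j < int t\<close> by force
    ultimately show False using less.IH[of t] k \<open>int j < int t\<close> less.prems by auto
  qed
qed

text \<open>Neither \<open>key i\<close> nor any key strictly in between has been searched, so by
  \<open>touch_searched\<close> they only have initial points, at negative times. The latest point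
  of \<open>key j\<close>, at a positive time, is therefore unobstructed.\<close>

lemma predecessor_touched:
  assumes "1 \<le> j" "j < i" "i \<le> length S" "key j < key i"
    and pred: "\<And>l. \<lbrakk>1 \<le> l; l < i; key j < key l\<rbrakk> \<Longrightarrow> \<not> key l < key i"
  shows "key j \<in> touch i"
proof -
  define T where "T = {t. (key j, t) \<in> G (i - 1)}"
  have "finite T"
    unfolding T_def
    by (rule finite_subset[of _ "snd ` G (i - 1)"])
       (auto simp: finite_greedy[OF initial_tree_mirror] intro: image_eqI[rotated])
  have "int j \<in> T" using assms by (auto simp: T_def search_in_greedy)
  then have max: "Max T \<in> T" "int j \<le> Max T" "\<And>t. t \<in> T \<Longrightarrow> t \<le> Max T"
    using \<open>finite T\<close> by (auto intro: Max_in)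
  have "(y, u) = (key j, Max T)"
    if yu: "(y, u) \<in> G (i - 1)" "key j \<le> y" "y \<le> key i" "Max T \<le> u" for y u
  proof -
    have "\<exists>l. 1 \<le> l \<and> l < i \<and> y = key l"
      using yu(1)
    proof (cases rule: greedy_cases)
      case (initial l)
      then show ?thesis using yu(4) max(2) assms(1) by simp
    next
      case (search l)
      then show ?thesis using assms by (intro exI[of _ l]) auto
    next
      case (touch l)
      then have "1 \<le> l" "l \<le> length S" "l < i" using assms by auto
      then show ?thesis using touch_searched[OF touch(3)] less_trans by metis
    qed
    then obtain l where l: "1 \<le> l" "l < i" "y = key l" by blast
    then have "y \<noteq> key i" using key_inj[of l i] assms by auto
    then have "y = key j" using pred[of l] l yu by force
    then show ?thesis using max(3)[of u] yu by (auto simp: T_def)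
  qed
  then show ?thesis
    using assms max(1) touch_iff[of i "key j"] by (auto simp: T_def min_def max_def)
qed

section \<open>Charging the touches of an ascent\<close>

definition passed :: "nat \<Rightarrow> nat set" where
  "passed i = {x \<in> key ` {1..<i}. key (i - 1) \<le> x \<and> x < key i}"

text \<open>A common key \<open>key k\<close> would give times \<open>k < i < j - 1\<close> with
  \<open>key (j - 1) < key k < key i\<close>, the forbidden pattern.\<close>

lemma passed_disjoint:
  assumes "1 \<le> i" "i < j" "j \<le> length S"
  shows "passed i \<inter> passed j = {}"
proof (rule ccontr)
  assume "passed i \<inter> passed j \<noteq> {}"
  then obtain x where x: "x \<in> passed i" "x \<in> passed j" by blast
  from x(1) obtain k where "1 \<le> k" "k < i" "x = key k" "key k < key i"
    by (auto simp: passed_def)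
  with x(2) have k: "1 \<le> k" "k < i" "key k < key i" "key (j - 1) \<le> key k"
    by (simp_all add: passed_def)
  then have "i \<noteq> j - 1" by auto
  then have "i < j - 1" using assms by auto
  then have "key (j - 1) \<noteq> key k" using key_inj[of "j - 1" k] k assms by force
  then show False using no_231[of k i "j - 1"] k assms \<open>i < j - 1\<close> by force
qed

lemma sum_card_passed: "(\<Sum>i = 1..length S. card (passed i)) \<le> length S"
proof -
  have "(\<Sum>i = 1..length S. card (passed i)) = card (\<Union>i\<in>{1..length S}. passed i)"
  proof (rule card_UN_disjoint[symmetric])
    show "\<forall>i\<in>{1..length S}. \<forall>j\<in>{1..length S}. i \<noteq> j \<longrightarrow> passed i \<inter> passed j = {}"
    proof (intro ballI impI)
      fix i j assume "i \<in> {1..length S}" "j \<in> {1..length S}" "i \<noteq> j"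
      then show "passed i \<inter> passed j = {}"
        using passed_disjoint[of i j] passed_disjoint[of j i] by (cases "i < j") auto
    qed
  qed (auto simp: passed_def)
  also have "\<dots> \<le> card (key ` {1..length S})"
    by (intro card_mono) (auto simp: passed_def)
  also have "\<dots> \<le> length S" using card_image_le[of "{1..length S}" key] by simp
  finally show ?thesis .
qed

section \<open>Counting touches on either side of the searched key\<close>

lemma card_le_one:
  fixes A :: "nat set"
  assumes "finite A" "\<And>x y. \<lbrakk>x \<in> A; y \<in> A\<rbrakk> \<Longrightarrow> \<not> x < y"
  shows "card A \<le> 1"
  unfolding One_nat_def card_le_Suc0_iff_eq[OF assms(1)]
  by (meson assms(2) linorder_neqE_nat)

lemma finite_touch: "finite (touch i)"
  unfolding touch_def by (intro finite_imageI finite_touched finite_greedy initial_tree_mirror)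

text \<open>A touched key was searched earlier, so \<open>not_touch_right\<close> excludes every key
  beyond it.\<close>

lemma card_touch_right:
  assumes "1 \<le> i" "i \<le> length S"
  shows "card {x \<in> touch i. key i < x} \<le> 1"
proof (rule card_le_one)
  fix x y assume "x \<in> {x \<in> touch i. key i < x}" "y \<in> {x \<in> touch i. key i < x}"
  moreover from this obtain j where "1 \<le> j" "j < i" "x = key j"
    using touch_searched[of x i] assms by blast
  ultimately show "\<not> x < y" using not_touch_right assms by blast
qed (simp add: finite_touch)

lemma card_touch_left:
  assumes "1 \<le> i" "i \<le> length S"
  shows "card {x \<in> touch i. x < key i} \<le> 1 + card (passed i)"
proof (cases "key (i - 1) < key i")
  case True
  have "{x \<in> touch i. x < key i} \<subseteq> passed i"
  proof
    fix x assume "x \<in> {x \<in> touch i. x < key i}"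
    then have x: "x \<in> touch i" "x < key i" by auto
    then obtain j t where j: "1 \<le> j" "j < i" "x = key j" "t < i"
      and latest: "\<And>y u. \<lbrakk>(y, u) \<in> G (i - 1); min x (key i) \<le> y; y \<le> max x (key i); y \<noteq> x\<rbrakk>
        \<Longrightarrow> u < int t"
      using touchE[OF x(1) assms] by metis
    \<comment> \<open>Otherwise the point searched at time \<open>i - 1\<close> lies between
      \<open>x\<close> and \<open>key i\<close>, and no point of \<open>x\<close> is later.\<close>
    have "key (i - 1) \<le> x"
    proof (rule ccontr)
      assume "\<not> key (i - 1) \<le> x"
      then have "int (i - 1) < int t"
        using j True by (intro latest[of "key (i - 1)"] search_in_greedy) auto
      then show False using j by auto
    qed
    then show "x \<in> passed i" using j x by (auto simp: passed_def)
  qed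
  then have "card {x \<in> touch i. x < key i} \<le> card (passed i)"
    by (rule card_mono[rotated]) (simp add: passed_def)
  then show ?thesis by simp
next
  \<comment> \<open>This includes \<open>i = 1\<close>, where truncated subtraction makes
    \<open>key 0\<close> equal to \<open>key 1\<close>; the touched key \<open>y\<close> below
    forces \<open>i\<close> to be at least 2.\<close>
  case False
  have "card {x \<in> touch i. x < key i} \<le> 1"
  proof (rule card_le_one)
    fix x y assume "x \<in> {x \<in> touch i. x < key i}" "y \<in> {x \<in> touch i. x < key i}"
    then have xy: "x \<in> touch i" "x < key i" "y \<in> touch i" "y < key i" by auto
    show "\<not> x < y"
    proof
      assume "x < y"
      obtain k where k: "1 \<le> k" "k < i" "y = key k" using touch_searched[OF xy(3) assms] .
      \<comment> \<open>\<open>Max P\<close> is the predecessor of \<open>key i\<close> among the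
        searched keys; its point at time \<open>i - 1\<close> will block \<open>x\<close>.\<close>
      define P where "P = {z \<in> key ` {1..<i}. z < key i}"
      have "finite P" "y \<in> P" using k xy by (auto simp: P_def)
      then have max: "Max P \<in> P" "y \<le> Max P" "\<And>z. z \<in> P \<Longrightarrow> z \<le> Max P"
        by (auto intro: Max_in)
      then obtain m where m: "1 \<le> m" "m < i" "Max P = key m" "key m < key i"
        by (auto simp: P_def)
      have "key (i - 1) > key i"
        using False key_inj[of i "i - 1"] k assms by fastforce
      then have "m \<noteq> i - 1" using m by auto
      then have "m < i - 1" using m by auto
      \<comment> \<open>\<open>key m\<close> is also the predecessor of \<open>key (i - 1)\<close>:
        an earlier searched key between \<open>key i\<close> and \<open>key (i - 1)\<close> would
        complete the pattern at \<open>l\<close>, \<open>i - 1\<close>, \<open>i\<close>.\<close>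
      have "key m \<in> touch (i - 1)"
      proof (rule predecessor_touched)
        fix l assume l: "1 \<le> l" "l < i - 1" "key m < key l"
        show "\<not> key l < key (i - 1)"
        proof
          assume "key l < key (i - 1)"
          moreover have "\<not> key l < key i"
          proof
            assume "key l < key i"
            then have "key l \<in> P" using l by (auto simp: P_def)
            then show False using max(3)[of "key l"] m l by simp
          qed
          moreover have "l < i" using l(2) by simp
          then have "key l \<noteq> key i" using key_inj[of l i] l(1) assms by force
          ultimately show False using no_231[of l "i - 1" i] l(1,2) assms by force
        qed
      qed (use m \<open>m < i - 1\<close> assms \<open>key (i - 1) > key i\<close> in auto)
      then have "(key m, int (i - 1)) \<in> G (i - 1)"
        using m \<open>m < i - 1\<close> by (intro touch_in_greedy) auto
      moreover obtain t where "t < i"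
        and "\<And>y u. \<lbrakk>(y, u) \<in> G (i - 1); min x (key i) \<le> y; y \<le> max x (key i); y \<noteq> x\<rbrakk> \<Longrightarrow> u < int t"
        using touchE[OF xy(1) assms] by metis
      moreover have "x < key m" using \<open>x < y\<close> max(2) m(3) by simp
      ultimately have "int (i - 1) < int t" using m(4) by simp
      then show False using \<open>t < i\<close> by auto
    qed
  qed (simp add: finite_touch)
  then show ?thesis by simp
qed

lemma card_touched:
  assumes "1 \<le> i" "i \<le> length S"
  shows "card (touched (G (i - 1)) (search_point S i)) \<le> 2 + card (passed i)"
proof -
  have "inj_on fst (touched (G (i - 1)) (search_point S i))"
    by (auto simp: inj_on_def touched_def)
  then have "card (touched (G (i - 1)) (search_point S i)) = card (touch i)"
    unfolding touch_def by (rule card_image[symmetric])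
  also have "touch i = {x \<in> touch i. key i < x} \<union> {x \<in> touch i. x < key i}"
    using touch_iff[OF assms(1)] by (auto simp: nat_neq_iff)
  also have "card \<dots> \<le> card {x \<in> touch i. key i < x} + card {x \<in> touch i. x < key i}"
    by (rule card_Un_le)
  also have "\<dots> \<le> 2 + card (passed i)"
    using card_touch_right[OF assms] card_touch_left[OF assms] by simp
  finally show ?thesis .
qed

text \<open>With \<open>n = length S\<close>: \<open>n\<close> for the searches,
  \<open>2 * n\<close> for at most two uncharged touches per search, and \<open>n\<close> for all
  passed keys together.\<close>

lemma greedy_cost_le: "greedy_cost (mirror (search_points S)) S \<le> 4 * length S"
proof -
  have "(\<Sum>i = 1..length S. card (touched (G (i - 1)) (search_point S i)))
      \<le> (\<Sum>i = 1..length S. 2 + card (passed i))"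
    by (intro sum_mono card_touched) auto
  also have "\<dots> = 2 * length S + (\<Sum>i = 1..length S. card (passed i))"
    by (simp only: sum.distrib) simp
  finally show ?thesis using sum_card_passed by (simp add: greedy_cost_def)
qed

end

theorem theorem1:
  "\<exists>c::real. c > 0 \<and>
     (\<forall>n\<ge>1. \<forall>S. preorder_sequence n S \<longrightarrow>
        real (greedy_cost (mirror (search_points S)) S) \<le> c * real n)"
proof (intro exI[of _ 4] conjI allI impI)
  fix n :: nat and S :: "nat list"
  assume "preorder_sequence n S"
  then have S: "distinct S" "avoids_231 S" "set S = {1..n}"
    by (auto simp: preorder_sequence_def permutations_of_set_def)
  then have "length S = n" using distinct_card[of S] by simp
  interpret preorder_search S by unfold_locales (use S in auto)
  show "real (greedy_cost (mirror (search_points S)) S) \<le> 4 * real n"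
    using greedy_cost_le \<open>length S = n\<close> by simp
qed simp

end
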